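(* Let $K$ be a field containing $\mathbb{Q}$ and let $r\in\widetilde{K}$. Then there exist an integer $m\geq 1$ and a polynomial $T(x,x_1,\dots,x_m)\in\mathbb{Q}[x,x_1,\dots,x_m]$ such that for all $x\in K$: $x=r$ if and only if there exist $x_1,\dots,x_m\in K$ with $T(x,x_1,\dots,x_m)=0$.
   Context: Let $K$ be a field. For $r\in K$, a finite set $A(r)$ with $\{r\}\subseteq A(r)\subseteq K$ is called adequate for $r$ if every mapping $f:A(r)\to K$ satisfying (1) if $1\in A(r)$ then $f(1)=1$; (2) if $a,b\in A(r)$ and $a+b\in A(r)$ then $f(a+b)=f(a)+f(b)$; (3) if $a,b\in A(r)$ and $a\cdot b\in A(r)$ then $f(a\cdot b)=f(a)\cdot f(b)$, also satisfies $f(r)=r$. $\widetilde{K}$ denotes the set of all $r\in K$ for which some finite set adequate for $r$ exists. *)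

theory Defs
  imports Main "HOL.Rat"
begin

definition adequate_for :: "'a::field \<Rightarrow> 'a set \<Rightarrow> bool" where
  "adequate_for r A \<longleftrightarrow> finite A \<and> r \<in> A \<and>
     (\<forall>f :: 'a \<Rightarrow> 'a.
        (1 \<in> A \<longrightarrow> f 1 = 1) \<longrightarrow>
        (\<forall>a\<in>A. \<forall>b\<in>A. a + b \<in> A \<longrightarrow> f (a + b) = f a + f b) \<longrightarrow>
        (\<forall>a\<in>A. \<forall>b\<in>A. a * b \<in> A \<longrightarrow> f (a * b) = f a * f b) \<longrightarrow>
        f r = r)"

definition Ktilde :: "'a::field set" where
  "Ktilde = {r. \<exists>A. adequate_for r A}"

text \<open>Multivariate polynomials with rational coefficients, as formal expressions
  in the variables indexed by natural numbers (variable 0 is x, variable i is x_i).\<close>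
datatype qpoly = QConst rat | QVar nat | QAdd qpoly qpoly | QMul qpoly qpoly

fun qeval :: "(nat \<Rightarrow> 'a::field_char_0) \<Rightarrow> qpoly \<Rightarrow> 'a" where
  "qeval v (QConst c) = of_rat c"
| "qeval v (QVar i) = v i"
| "qeval v (QAdd p q) = qeval v p + qeval v q"
| "qeval v (QMul p q) = qeval v p * qeval v q"

fun qvars :: "qpoly \<Rightarrow> nat set" where
  "qvars (QConst c) = {}"
| "qvars (QVar i) = {i}"
| "qvars (QAdd p q) = qvars p \<union> qvars q"
| "qvars (QMul p q) = qvars p \<union> qvars q"

end

theory Submission
  imports Defs "HOL-Algebra.Algebraic_Closure_Type"
begin

text \<open>
  The conditions on a map from an adequate set to K form a finite system of polynomial equations
  over the rationals whose solutions in K all have the same r-coordinate.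

  If some nonconstant rational polynomial has no root in K, its homogenization is a binary form
  that vanishes only at the origin, and nesting it merges the system into one equation.

  Otherwise r is rational, so that x - r will do. Indeed the ring generated by the adequate
  set has a homomorphism to the algebraic numbers (Nullstellensatz). If the image y of r is
  irrational, composing with an embedding that moves y gives a second homomorphism with a
  different value at r. Finitely many algebraic numbers lie in some \<rat>(\<theta>), and \<rat>(\<theta>)
  embeds into K because the minimal polynomial of \<theta> has a root there. This yields two solutions
  in K with different r-coordinates. If y is rational, the same embedding sends r to the rational y,
  hence r = y.
\<close>

section \<open>Polynomials over subrings\<close>

definition unital_subring :: "'a::comm_ring_1 set \<Rightarrow> bool" where
  "unital_subring B \<longleftrightarrow> 1 \<in> B \<and> (\<forall>x\<in>B. - x \<in> B) \<and>
     (\<forall>x\<in>B. \<forall>y\<in>B. x + y \<in> B \<and> x * y \<in> B)"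

definition poly_over :: "'a::comm_ring_1 set \<Rightarrow> 'a poly set" where
  "poly_over B = {p. \<forall>i. coeff p i \<in> B}"

definition adjoin :: "'a::comm_ring_1 set \<Rightarrow> 'a \<Rightarrow> 'a set" where
  "adjoin B a = (\<lambda>p. poly p a) ` poly_over B"

definition hom_on :: "'a::comm_ring_1 set \<Rightarrow> ('a \<Rightarrow> 'b::comm_ring_1) \<Rightarrow> bool" where
  "hom_on B \<phi> \<longleftrightarrow> \<phi> 1 = 1 \<and>
     (\<forall>x\<in>B. \<forall>y\<in>B. \<phi> (x + y) = \<phi> x + \<phi> y \<and> \<phi> (x * y) = \<phi> x * \<phi> y)"

text \<open>\<open>B\<close> is only a ring, so \<open>P\<close> need not be monic or unique: just
  its degree is determined. Hence the powers of \<open>lead_coeff P\<close> below.\<close>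

definition min_poly_over :: "'a::comm_ring_1 set \<Rightarrow> 'a \<Rightarrow> 'a poly \<Rightarrow> bool" where
  "min_poly_over B a P \<longleftrightarrow> P \<in> poly_over B \<and> P \<noteq> 0 \<and> poly P a = 0 \<and>
     (\<forall>g\<in>poly_over B. g \<noteq> 0 \<longrightarrow> poly g a = 0 \<longrightarrow> degree P \<le> degree g)"

lemma
  assumes "unital_subring B"
  shows subring_1: "1 \<in> B"
    and subring_0: "0 \<in> B"
    and subring_uminus: "x \<in> B \<Longrightarrow> - x \<in> B"
    and subring_add: "x \<in> B \<Longrightarrow> y \<in> B \<Longrightarrow> x + y \<in> B"
    and subring_diff: "x \<in> B \<Longrightarrow> y \<in> B \<Longrightarrow> x - y \<in> B"
    and subring_mult: "x \<in> B \<Longrightarrow> y \<in> B \<Longrightarrow> x * y \<in> B"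
proof -
  show 1: "1 \<in> B" and u: "x \<in> B \<Longrightarrow> - x \<in> B" and a: "x \<in> B \<Longrightarrow> y \<in> B \<Longrightarrow> x + y \<in> B"
    and "x \<in> B \<Longrightarrow> y \<in> B \<Longrightarrow> x * y \<in> B" for x y
    using assms by (auto simp: unital_subring_def)
  show "x \<in> B \<Longrightarrow> y \<in> B \<Longrightarrow> x - y \<in> B" for x y
    using a[of x "- y"] u[of y] by simp
  show "0 \<in> B" using a[OF 1 u[OF 1]] by simp
qed

lemma subring_sum:
  assumes "unital_subring B" "\<And>i. i \<in> I \<Longrightarrow> f i \<in> B"
  shows "sum f I \<in> B"
  using assms(2) by (induction I rule: infinite_finite_induct)
    (simp_all add: subring_0[OF assms(1)] subring_add[OF assms(1)])

lemma subring_power: "unital_subring B \<Longrightarrow> x \<in> B \<Longrightarrow> x ^ n \<in> B"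
  by (induction n) (auto intro: subring_1 subring_mult)

lemma subring_of_nat: "unital_subring B \<Longrightarrow> of_nat n \<in> B"
  by (induction n) (auto intro: subring_0 subring_1 subring_add)

lemma poly_over_const: "unital_subring B \<Longrightarrow> c \<in> B \<Longrightarrow> [:c:] \<in> poly_over B"
  by (auto simp: poly_over_def coeff_pCons intro: subring_0 split: nat.splits)

lemma poly_over_X: "unital_subring B \<Longrightarrow> [:0, 1:] \<in> poly_over B"
  by (auto simp: poly_over_def coeff_pCons intro: subring_0 subring_1 split: nat.splits)

lemma poly_over_monom: "unital_subring B \<Longrightarrow> c \<in> B \<Longrightarrow> monom c n \<in> poly_over B"
  by (auto simp: poly_over_def intro: subring_0)

lemma subring_poly_over: "unital_subring B \<Longrightarrow> unital_subring (poly_over B)"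
  unfolding unital_subring_def[of "poly_over B"]
  by (auto simp: poly_over_def coeff_mult coeff_1
      intro!: subring_sum subring_add subring_mult subring_uminus
      intro: subring_0 subring_1)

lemma poly_over_smult:
  "unital_subring B \<Longrightarrow> c \<in> B \<Longrightarrow> p \<in> poly_over B \<Longrightarrow> smult c p \<in> poly_over B"
  by (auto simp: poly_over_def intro: subring_mult)

lemma poly_over_pderiv: "unital_subring B \<Longrightarrow> p \<in> poly_over B \<Longrightarrow> pderiv p \<in> poly_over B"
  unfolding poly_over_def
  by (auto simp: coeff_pderiv simp del: of_nat_Suc intro!: subring_mult subring_of_nat)

lemma poly_over_mono: "B \<subseteq> C \<Longrightarrow> poly_over B \<subseteq> poly_over C"
  by (auto simp: poly_over_def)

lemma poly_over_pcompose:
  assumes B: "unital_subring B" and q: "q \<in> poly_over B"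
  shows "p \<in> poly_over B \<Longrightarrow> pcompose p q \<in> poly_over B"
proof (induction p)
  case 0
  then show ?case by simp
next
  case (pCons c p)
  have "c \<in> B" using pCons.prems by (auto simp: poly_over_def coeff_pCons split: nat.splits dest: spec[of _ 0])
  moreover have "p \<in> poly_over B"
    using pCons.prems by (auto simp: poly_over_def coeff_pCons dest: spec[of _ "Suc _"])
  ultimately show ?case
    unfolding pcompose_pCons using pCons.IH q subring_poly_over[OF B]
    by (intro subring_add[of "poly_over B"] subring_mult[of "poly_over B"] poly_over_const[OF B])
qed

lemma subring_adjoin:
  assumes B: "unital_subring B"
  shows "unital_subring (adjoin B a)"
proof -
  note S = subring_poly_over[OF B]
  show ?thesis
    unfolding unital_subring_def
  proof (intro conjI ballI)
    show "1 \<in> adjoin B a" unfolding adjoin_def using subring_1[OF S] by force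
  next
    fix x assume "x \<in> adjoin B a"
    then show "- x \<in> adjoin B a"
      using subring_uminus[OF S] by (auto simp: adjoin_def simp flip: poly_minus)
  next
    fix x y assume "x \<in> adjoin B a" "y \<in> adjoin B a"
    then obtain p q where "p \<in> poly_over B" "q \<in> poly_over B" "x = poly p a" "y = poly q a"
      by (auto simp: adjoin_def)
    then show "x + y \<in> adjoin B a" "x * y \<in> adjoin B a"
      using subring_add[OF S, of p q] subring_mult[OF S, of p q]
      by (auto simp: adjoin_def simp flip: poly_add poly_mult)
  qed
qed

lemma adjoin_base: "unital_subring B \<Longrightarrow> B \<subseteq> adjoin B a"
  unfolding adjoin_def using poly_over_const by force

lemma adjoin_elem: "unital_subring B \<Longrightarrow> a \<in> adjoin B a"
  unfolding adjoin_def using poly_over_X by force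

lemma adjoin_least:
  assumes "unital_subring C" "B \<subseteq> C" "a \<in> C"
  shows "adjoin B a \<subseteq> C"
  using assms by (auto simp: adjoin_def poly_over_def poly_altdef intro!: subring_sum subring_mult subring_power)

section \<open>Ring homomorphisms defined on a subring\<close>

lemma
  assumes "hom_on B \<phi>"
  shows hom_on_1: "\<phi> 1 = 1"
    and hom_on_add: "x \<in> B \<Longrightarrow> y \<in> B \<Longrightarrow> \<phi> (x + y) = \<phi> x + \<phi> y"
    and hom_on_mult: "x \<in> B \<Longrightarrow> y \<in> B \<Longrightarrow> \<phi> (x * y) = \<phi> x * \<phi> y"
  using assms by (auto simp: hom_on_def)

lemma
  assumes B: "unital_subring B" and h: "hom_on B \<phi>"
  shows hom_on_0: "\<phi> 0 = 0"
    and hom_on_diff: "x \<in> B \<Longrightarrow> y \<in> B \<Longrightarrow> \<phi> (x - y) = \<phi> x - \<phi> y"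
proof -
  have "\<phi> (0 + 0) = \<phi> 0 + \<phi> 0" using h subring_0[OF B] unfolding hom_on_def by blast
  then show 0: "\<phi> 0 = 0" by simp
  have u: "\<phi> (- x) = - \<phi> x" if "x \<in> B" for x
  proof -
    have "\<phi> (x + - x) = \<phi> x + \<phi> (- x)"
      using h that subring_uminus[OF B] unfolding hom_on_def by blast
    then show ?thesis using 0 by (simp add: eq_neg_iff_add_eq_0 add.commute)
  qed
  show "\<phi> (x - y) = \<phi> x - \<phi> y" if "x \<in> B" "y \<in> B"
  proof -
    have "\<phi> (x + - y) = \<phi> x + \<phi> (- y)"
      using h that subring_uminus[OF B] unfolding hom_on_def by blast
    then show ?thesis using u[of y] that by simp
  qed
qed

lemma hom_on_sum:
  assumes B: "unital_subring B" and h: "hom_on B \<phi>" and "\<And>i. i \<in> I \<Longrightarrow> f i \<in> B"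
  shows "\<phi> (sum f I) = (\<Sum>i\<in>I. \<phi> (f i))"
  using assms(3)
proof (induction I rule: infinite_finite_induct)
  case (insert x F)
  then have "sum f F \<in> B" by (intro subring_sum[OF B]) auto
  then show ?case using insert h by (simp add: hom_on_def)
qed (simp_all add: hom_on_0[OF B h])

lemma hom_on_power:
  assumes B: "unital_subring B" and h: "hom_on B \<phi>" and "x \<in> B"
  shows "\<phi> (x ^ n) = \<phi> x ^ n"
  using h subring_power[OF B \<open>x \<in> B\<close>] \<open>x \<in> B\<close> by (induction n) (auto simp: hom_on_def)

lemma hom_on_map_poly:
  assumes B: "unital_subring B" and h: "hom_on B \<phi>"
  shows "hom_on (poly_over B) (map_poly \<phi>)"
  unfolding hom_on_def
proof (intro conjI ballI)
  note 0 = hom_on_0[OF B h]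
  show "map_poly \<phi> 1 = 1" using h by (simp add: hom_on_def)
  fix p q assume pq: "p \<in> poly_over B" "q \<in> poly_over B"
  show "map_poly \<phi> (p + q) = map_poly \<phi> p + map_poly \<phi> q"
    using pq h by (intro poly_eqI) (simp add: coeff_map_poly 0 poly_over_def hom_on_def)
  show "map_poly \<phi> (p * q) = map_poly \<phi> p * map_poly \<phi> q"
  proof (intro poly_eqI)
    fix n
    have "\<phi> (\<Sum>i\<le>n. coeff p i * coeff q (n - i)) = (\<Sum>i\<le>n. \<phi> (coeff p i * coeff q (n - i)))"
      using pq by (intro hom_on_sum[OF B h] subring_mult[OF B]) (auto simp: poly_over_def)
    also have "\<dots> = (\<Sum>i\<le>n. \<phi> (coeff p i) * \<phi> (coeff q (n - i)))"
      using pq h by (intro sum.cong) (auto simp: poly_over_def hom_on_def)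
    finally show "coeff (map_poly \<phi> (p * q)) n = coeff (map_poly \<phi> p * map_poly \<phi> q) n"
      by (simp add: coeff_map_poly 0 coeff_mult)
  qed
qed

section \<open>Pseudo-division and minimal polynomials over a ring\<close>

lemma poly_over_pseudo_divide:
  fixes P :: "'a::idom poly"
  assumes B: "unital_subring B" and P: "P \<in> poly_over B" "P \<noteq> 0"
  shows "g \<in> poly_over B \<Longrightarrow> \<exists>k. \<exists>q\<in>poly_over B. \<exists>s\<in>poly_over B.
    smult (lead_coeff P ^ k) g = q * P + s \<and> (s = 0 \<or> degree s < degree P)"
\<comment> \<open>The shift by one puts \<open>0\<close> below the nonzero constants; the bare
  degree would not drop when a constant is divided by a constant.\<close>
proof (induction "if g = 0 then 0 else Suc (degree g)" arbitrary: g rule: less_induct)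
  case less
  note S = subring_poly_over[OF B]
  let ?l = "lead_coeff P"
  show ?case
  proof (cases "g = 0 \<or> degree g < degree P")
    case True
    then show ?thesis using less.prems subring_0[OF S]
      by (intro exI[of _ 0] bexI[of _ 0] bexI[of _ g]) auto
  next
    case False
    define m where "m = monom (lead_coeff g) (degree g - degree P)"
    define g1 where "g1 = smult ?l g - m * P"
    have m: "m \<in> poly_over B"
      unfolding m_def using less.prems by (intro poly_over_monom B) (auto simp: poly_over_def)
    have lB: "?l \<in> B" using P by (auto simp: poly_over_def)
    have g1: "g1 \<in> poly_over B" unfolding g1_def
      using less.prems P m lB by (intro subring_diff[OF S] subring_mult[OF S] poly_over_smult[OF B])
    have m0: "m \<noteq> 0" using False by (simp add: m_def)
    have deg: "degree (m * P) = degree g"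
      using False P m0 by (simp add: degree_mult_eq m_def degree_monom_eq)
    have lc: "lead_coeff (m * P) = lead_coeff g * ?l"
      unfolding lead_coeff_mult using False by (simp add: m_def degree_monom_eq)
    have c: "coeff g1 (degree g) = 0"
      using lc unfolding deg by (simp add: g1_def)
    have "degree g1 \<le> degree g" unfolding g1_def
      by (intro degree_diff_le) (auto simp: deg intro: degree_smult_le)
    then have "g1 = 0 \<or> degree g1 < degree g" using c
      by (metis leading_coeff_0_iff le_neq_implies_less)
    then have "(if g1 = 0 then 0 else Suc (degree g1)) < (if g = 0 then 0 else Suc (degree g))"
      using False by auto
    from less.hyps[OF this g1] obtain k q s where
      IH: "q \<in> poly_over B" "s \<in> poly_over B" "smult (?l ^ k) g1 = q * P + s" "s = 0 \<or> degree s < degree P"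
      by blast
    have "smult (?l ^ Suc k) g = (q + smult (?l ^ k) m) * P + s"
    proof -
      have "smult (?l ^ Suc k) g = smult (?l ^ k) g1 + smult (?l ^ k) (m * P)"
        by (simp add: g1_def smult_diff_right mult.commute)
      then show ?thesis using IH(3) by (simp add: algebra_simps)
    qed
    moreover have "q + smult (?l ^ k) m \<in> poly_over B"
      using IH(1) m lB by (intro subring_add[OF S] poly_over_smult[OF B] subring_power[OF B])
    ultimately show ?thesis using IH(2,4) by blast
  qed
qed

lemma min_poly_over_exists:
  assumes "g \<in> poly_over B" "g \<noteq> 0" "poly g a = 0"
  obtains P where "min_poly_over B a P"
proof -
  have "\<exists>P. (P \<in> poly_over B \<and> P \<noteq> 0 \<and> poly P a = 0) \<and>
     (\<forall>h. h \<in> poly_over B \<and> h \<noteq> 0 \<and> poly h a = 0 \<longrightarrow> degree P \<le> degree h)"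
    by (rule ex_has_least_nat[of _ g]) (use assms in simp)
  then show ?thesis using that by (auto simp: min_poly_over_def)
qed

lemma min_poly_over_degree:
  assumes "min_poly_over B a P"
  shows "degree P > 0"
proof (rule ccontr)
  assume "\<not> degree P > 0"
  then obtain c where "P = [:c:]" by (metis degree_eq_zeroE gr0I)
  then show False using assms by (auto simp: min_poly_over_def)
qed

text \<open>The remainder of the pseudo-division vanishes at \<open>a\<close> and has smaller degree
  than \<open>P\<close>, so minimality makes it zero.\<close>

lemma min_poly_over_divides:
  fixes P :: "'a::idom poly"
  assumes B: "unital_subring B" and P: "min_poly_over B a P" and g: "g \<in> poly_over B" "poly g a = 0"
  obtains k q where "q \<in> poly_over B" "smult (lead_coeff P ^ k) g = q * P"
proof -
  have P': "P \<in> poly_over B" "P \<noteq> 0" "poly P a = 0" using P by (auto simp: min_poly_over_def)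
  obtain k q s where qs: "q \<in> poly_over B" "s \<in> poly_over B"
    "smult (lead_coeff P ^ k) g = q * P + s" "s = 0 \<or> degree s < degree P"
    using poly_over_pseudo_divide[OF B P'(1,2) g(1)] by blast
  have "poly s a = 0" using arg_cong[OF qs(3), of "\<lambda>p. poly p a"] P' g by simp
  then have "s = 0" using qs P unfolding min_poly_over_def by (metis not_le)
  then show ?thesis using that qs by simp
qed

text \<open>Euclidean descent: pseudo-dividing \<open>P\<close> by \<open>p\<close> leaves a
  remainder whose value at \<open>a\<close> is a multiple of \<open>poly p a\<close>. Iteration
  lowers the degree down to a nonzero constant, which lies in \<open>B\<close>.\<close>

lemma min_poly_over_inverse_aux:
  fixes P :: "'a::idom poly"
  assumes B: "unital_subring B" and P: "min_poly_over B a P"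
  shows "p \<in> poly_over B \<Longrightarrow> p \<noteq> 0 \<Longrightarrow> degree p < degree P \<Longrightarrow>
    \<exists>s\<in>poly_over B. poly s a * poly p a \<in> B - {0}"
proof (induction "degree p" arbitrary: p rule: less_induct)
  case less
  note S = subring_poly_over[OF B]
  have P': "P \<in> poly_over B" "P \<noteq> 0" "poly P a = 0" using P by (auto simp: min_poly_over_def)
  show ?case
  proof (cases "degree p = 0")
    case True
    then obtain c where c: "p = [:c:]" by (metis degree_eq_zeroE)
    then have "c \<in> B" using less.prems by (auto simp: poly_over_def coeff_pCons dest: spec[of _ 0])
    then show ?thesis using c less.prems subring_1[OF S] by (intro bexI[of _ 1]) auto
  next
    case False
    obtain k q s where qs: "q \<in> poly_over B" "s \<in> poly_over B"
      "smult (lead_coeff p ^ k) P = q * p + s" "s = 0 \<or> degree s < degree p"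
      using poly_over_pseudo_divide[OF B less.prems(1,2) P'(1)] by blast
    have eq: "poly q a * poly p a = - poly s a"
      using arg_cong[OF qs(3), of "\<lambda>p. poly p a"] P' by (simp add: eq_neg_iff_add_eq_0)
    \<comment> \<open>If \<open>s = 0\<close>, then \<open>q\<close> vanishes at \<open>a\<close>,
      because \<open>p\<close> does not, and its degree is below that of \<open>P\<close>.\<close>
    have "s \<noteq> 0"
    proof
      assume s: "s = 0"
      have q0: "q \<noteq> 0" using qs(3) s P' less.prems(2) by auto
      have pa: "poly p a \<noteq> 0" using P less.prems unfolding min_poly_over_def by (metis not_le)
      then have "poly q a = 0" using eq s by simp
      then have "degree P \<le> degree q" using P q0 qs(1) unfolding min_poly_over_def by blast
      moreover have "degree P = degree q + degree p"
        using arg_cong[OF qs(3), of degree] s q0 less.prems(2) by (simp add: degree_mult_eq)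
      ultimately show False using False by simp
    qed
    then obtain t where t: "t \<in> poly_over B" "poly t a * poly s a \<in> B - {0}"
      using less.hyps[of s] qs less.prems by auto
    have "poly (- (t * q)) a * poly p a = poly t a * poly s a"
      using eq by (simp add: mult.assoc)
    moreover have "- (t * q) \<in> poly_over B" using t qs by (intro subring_uminus[OF S] subring_mult[OF S])
    ultimately show ?thesis using t by metis
  qed
qed

text \<open>A substitute for division: a representative of \<open>u\<close> is reduced modulo
  \<open>P\<close> so that the descent applies to it.\<close>

lemma min_poly_over_inverse:
  fixes P :: "'a::idom poly"
  assumes B: "unital_subring B" and P: "min_poly_over B a P" and u: "u \<in> adjoin B a" "u \<noteq> 0"
  obtains s where "s \<in> adjoin B a" "s * u \<in> B" "s * u \<noteq> 0"
proof -
  have P': "P \<in> poly_over B" "P \<noteq> 0" "poly P a = 0" using P by (auto simp: min_poly_over_def)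
  obtain p where p: "p \<in> poly_over B" "u = poly p a" using u by (auto simp: adjoin_def)
  obtain k q t where qs: "q \<in> poly_over B" "t \<in> poly_over B"
    "smult (lead_coeff P ^ k) p = q * P + t" "t = 0 \<or> degree t < degree P"
    using poly_over_pseudo_divide[OF B P'(1,2) p(1)] by blast
  have eq: "lead_coeff P ^ k * u = poly t a"
    using arg_cong[OF qs(3), of "\<lambda>p. poly p a"] P' p by simp
  have "t \<noteq> 0" using eq u P' by auto
  then obtain s where s: "s \<in> poly_over B" "poly s a * poly t a \<in> B - {0}"
    using min_poly_over_inverse_aux[OF B P, of t] qs by blast
  show ?thesis
  proof
    have "lead_coeff P ^ k \<in> B" using P' by (auto simp: poly_over_def intro: subring_power[OF B])
    then have "lead_coeff P ^ k \<in> adjoin B a" using adjoin_base[OF B] by blast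
    then show "poly s a * lead_coeff P ^ k \<in> adjoin B a"
      using s by (intro subring_mult[OF subring_adjoin[OF B]]) (auto simp: adjoin_def)
  qed (use s eq in \<open>auto simp: mult.assoc\<close>)
qed

section \<open>Extending a homomorphism to one more generator\<close>

lemma hom_on_adjoin:
  fixes \<phi> :: "'a::comm_ring_1 \<Rightarrow> 'b::comm_ring_1"
  assumes B: "unital_subring B" and h: "hom_on B \<phi>"
    and rel: "\<And>g. g \<in> poly_over B \<Longrightarrow> poly g a = 0 \<Longrightarrow> poly (map_poly \<phi> g) c = 0"
  obtains \<psi> where "hom_on (adjoin B a) \<psi>"
    "\<And>g. g \<in> poly_over B \<Longrightarrow> \<psi> (poly g a) = poly (map_poly \<phi> g) c"
proof -
  note S = subring_poly_over[OF B] and H = hom_on_map_poly[OF B h]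
  \<comment> \<open>The representing polynomial is chosen arbitrarily. Two choices differ by a
    relation of \<open>a\<close>, which \<open>rel\<close> turns into a relation of
    \<open>c\<close>.\<close>
  define \<psi> where "\<psi> x = poly (map_poly \<phi> (SOME g. g \<in> poly_over B \<and> poly g a = x)) c" for x
  have \<psi>: "\<psi> (poly g a) = poly (map_poly \<phi> g) c" if g: "g \<in> poly_over B" for g
  proof -
    define g' where "g' = (SOME g'. g' \<in> poly_over B \<and> poly g' a = poly g a)"
    have g': "g' \<in> poly_over B \<and> poly g' a = poly g a"
      unfolding g'_def by (rule someI[of _ g]) (use g in simp)
    then have "poly (map_poly \<phi> (g' - g)) c = 0"
      using g by (intro rel subring_diff[OF S]) auto
    then have "poly (map_poly \<phi> g') c = poly (map_poly \<phi> g) c"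
      using hom_on_diff[OF S H, of g' g] g g' by simp
    then show ?thesis by (simp add: \<psi>_def g'_def)
  qed
  have "hom_on (adjoin B a) \<psi>"
    unfolding hom_on_def
  proof (intro conjI ballI)
    have "\<psi> (poly 1 a) = poly (map_poly \<phi> 1) c" using \<psi> subring_1[OF S] by blast
    then show "\<psi> 1 = 1" using h by (simp add: hom_on_def)
  next
    fix x y assume "x \<in> adjoin B a" "y \<in> adjoin B a"
    then obtain p q where pq: "p \<in> poly_over B" "q \<in> poly_over B" "x = poly p a" "y = poly q a"
      by (auto simp: adjoin_def)
    have "\<psi> (poly (p + q) a) = poly (map_poly \<phi> (p + q)) c"
      "\<psi> (poly (p * q) a) = poly (map_poly \<phi> (p * q)) c"
      using pq by (blast intro: \<psi> subring_add[OF S] subring_mult[OF S])+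
    then show "\<psi> (x + y) = \<psi> x + \<psi> y" "\<psi> (x * y) = \<psi> x * \<psi> y"
      using pq \<psi> H by (simp_all add: hom_on_def)
  qed
  then show ?thesis using that \<psi> by blast
qed

text \<open>A root of the image of the single polynomial \<open>P\<close> suffices: any relation of
  \<open>a\<close>, times a power of \<open>lead_coeff P\<close>, is a multiple of \<open>P\<close>,
  and the image of that power is nonzero and cancels.\<close>

lemma hom_on_adjoin_algebraic:
  fixes \<phi> :: "'a::idom \<Rightarrow> 'b::idom"
  assumes B: "unital_subring B" and h: "hom_on B \<phi>" and P: "min_poly_over B a P"
    and l: "\<phi> (lead_coeff P) \<noteq> 0" and c: "poly (map_poly \<phi> P) c = 0"
  obtains \<psi> where "hom_on (adjoin B a) \<psi>"
    "\<And>g. g \<in> poly_over B \<Longrightarrow> \<psi> (poly g a) = poly (map_poly \<phi> g) c"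
proof (rule hom_on_adjoin[OF B h, of a c])
  note H = hom_on_map_poly[OF B h]
  fix g assume g: "g \<in> poly_over B" "poly g a = 0"
  obtain k q where q: "q \<in> poly_over B" "smult (lead_coeff P ^ k) g = q * P"
    using min_poly_over_divides[OF B P g] .
  have P': "P \<in> poly_over B" using P by (auto simp: min_poly_over_def)
  then have lB: "lead_coeff P \<in> B" by (auto simp: poly_over_def)
  have "map_poly \<phi> ([:lead_coeff P ^ k:] * g) = map_poly \<phi> [:lead_coeff P ^ k:] * map_poly \<phi> g"
    using H g lB poly_over_const[OF B] subring_power[OF B] unfolding hom_on_def by blast
  then have "map_poly \<phi> (smult (lead_coeff P ^ k) g) = smult (\<phi> (lead_coeff P) ^ k) (map_poly \<phi> g)"
    by (simp add: map_poly_pCons hom_on_0[OF B h] hom_on_power[OF B h lB])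
  moreover have "map_poly \<phi> (q * P) = map_poly \<phi> q * map_poly \<phi> P"
    using H q P' unfolding hom_on_def by blast
  ultimately have "smult (\<phi> (lead_coeff P) ^ k) (map_poly \<phi> g) = map_poly \<phi> q * map_poly \<phi> P"
    using q by simp
  from arg_cong[OF this, of "\<lambda>p. poly p c"] show "poly (map_poly \<phi> g) c = 0"
    using c l by simp
qed (use that in blast)

section \<open>Homomorphisms from finitely generated rings to an algebraically closed field\<close>

text \<open>Stronger than the existence of a homomorphism, so that it survives adjoining an element:
  the homomorphism on \<open>B\<close> must be chosen so as not to kill certain leading
  coefficients. The second argument only fixes the target type.\<close>

definition separated_by_homs :: "'a::comm_ring_1 set \<Rightarrow> 'b::comm_ring_1 itself \<Rightarrow> bool" where
  "separated_by_homs B _ \<longleftrightarrow> (\<forall>u\<in>B. u \<noteq> 0 \<longrightarrow> (\<exists>\<phi>::'a \<Rightarrow> 'b. hom_on B \<phi> \<and> \<phi> u \<noteq> 0))"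

lemma unital_subring_Ints: "unital_subring \<int>"
  by (auto simp: unital_subring_def)

lemma hom_on_Ints:
  "hom_on (\<int> :: 'a::{comm_ring_1,ring_char_0} set) (of_int \<circ> inv_into UNIV of_int :: 'a \<Rightarrow> 'b::comm_ring_1)"
proof -
  have inv: "inv_into UNIV (of_int :: int \<Rightarrow> 'a) (of_int n) = n" for n
    by (simp add: inj_on_def)
  show ?thesis
    unfolding hom_on_def Ints_def
    using inv[of 1] by (auto simp: inv simp flip: of_int_add of_int_mult)
qed

lemma separated_Ints:
  "separated_by_homs (\<int> :: 'a::{comm_ring_1,ring_char_0} set) TYPE('b::{comm_ring_1,ring_char_0})"
  unfolding separated_by_homs_def
proof (intro ballI impI)
  fix u :: 'a assume "u \<in> \<int>" "u \<noteq> 0"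
  then obtain n where n: "u = of_int n" "n \<noteq> 0" by (metis Ints_cases of_int_0)
  have "inv_into UNIV (of_int :: int \<Rightarrow> 'a) (of_int n) = n"
    by (simp add: inj_on_def)
  then show "\<exists>\<phi>::'a \<Rightarrow> 'b. hom_on \<int> \<phi> \<and> \<phi> u \<noteq> 0"
    using n by (intro exI[of _ "of_int \<circ> inv_into UNIV of_int"] conjI hom_on_Ints) simp
qed

lemma separated_adjoin:
  fixes B :: "'a::idom set"
  assumes B: "unital_subring B"
    and sep: "separated_by_homs B TYPE('b::{alg_closed_field,field_char_0})"
  shows "separated_by_homs (adjoin B a) TYPE('b)"
  unfolding separated_by_homs_def
proof (intro ballI impI)
  fix u assume u: "u \<in> adjoin B a" "u \<noteq> 0"
  show "\<exists>\<phi>::'a \<Rightarrow> 'b. hom_on (adjoin B a) \<phi> \<and> \<phi> u \<noteq> 0"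
  proof (cases "\<exists>P. min_poly_over B a P")
    case True
    then obtain P where P: "min_poly_over B a P" by blast
    then have P': "P \<in> poly_over B" "P \<noteq> 0" by (auto simp: min_poly_over_def)
    obtain s where s: "s \<in> adjoin B a" "s * u \<in> B" "s * u \<noteq> 0"
      using min_poly_over_inverse[OF B P u] .
    let ?l = "lead_coeff P"
    have l: "?l \<in> B" "?l \<noteq> 0" using P' by (auto simp: poly_over_def)
    \<comment> \<open>One element guards two requirements: the image of \<open>P\<close> must keep
      its degree in order to have a root, and the multiple \<open>s * u\<close> of \<open>u\<close>
      must survive.\<close>
    have "?l * (s * u) \<in> B" using subring_mult[OF B l(1) s(2)] .
    then obtain \<phi> :: "'a \<Rightarrow> 'b" where \<phi>: "hom_on B \<phi>" "\<phi> (?l * (s * u)) \<noteq> 0"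
      using sep l s unfolding separated_by_homs_def by (metis no_zero_divisors)
    then have nz: "\<phi> ?l \<noteq> 0" "\<phi> (s * u) \<noteq> 0" using l s unfolding hom_on_def by auto
    have "coeff (map_poly \<phi> P) (degree P) \<noteq> 0"
      using nz by (simp add: coeff_map_poly hom_on_0[OF B \<phi>(1)])
    then have "degree (map_poly \<phi> P) > 0"
      using le_degree min_poly_over_degree[OF P] by fastforce
    then obtain c where c: "poly (map_poly \<phi> P) c = 0" using alg_closed_imp_poly_has_root by blast
    obtain \<psi> where \<psi>: "hom_on (adjoin B a) \<psi>"
      "\<And>g. g \<in> poly_over B \<Longrightarrow> \<psi> (poly g a) = poly (map_poly \<phi> g) c"
      using hom_on_adjoin_algebraic[OF B \<phi>(1) P nz(1) c] by blast
    have "\<psi> (s * u) = \<phi> (s * u)"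
      using \<psi>(2)[OF poly_over_const[OF B s(2)]] by (simp add: map_poly_pCons hom_on_0[OF B \<phi>(1)])
    then have "\<psi> s * \<psi> u \<noteq> 0" using \<psi>(1) s(1) u(1) nz unfolding hom_on_def by auto
    then show ?thesis using \<psi>(1) by auto
  next
    case False
    \<comment> \<open>As \<open>a\<close> satisfies no relation over \<open>B\<close>, it may be
      sent to any \<open>c\<close>. Keeping \<open>lead_coeff p\<close> alive makes the image of
      \<open>p\<close> nonzero, and an infinite field contains a non-root of it.\<close>
    then have no: "\<not> (g \<in> poly_over B \<and> g \<noteq> 0 \<and> poly g a = 0)" for g
      using min_poly_over_exists by metis
    obtain p where p: "p \<in> poly_over B" "u = poly p a" using u by (auto simp: adjoin_def)
    then have "lead_coeff p \<in> B" "lead_coeff p \<noteq> 0" using u by (auto simp: poly_over_def)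
    then obtain \<phi> :: "'a \<Rightarrow> 'b" where \<phi>: "hom_on B \<phi>" "\<phi> (lead_coeff p) \<noteq> 0"
      using sep unfolding separated_by_homs_def by blast
    have "coeff (map_poly \<phi> p) (degree p) \<noteq> 0"
      using \<phi> by (simp add: coeff_map_poly hom_on_0[OF B \<phi>(1)])
    then have "map_poly \<phi> p \<noteq> 0" by auto
    then have "finite {c. poly (map_poly \<phi> p) c = 0}" by (rule poly_roots_finite)
    then obtain c where c: "poly (map_poly \<phi> p) c \<noteq> 0"
      using infinite_UNIV_char_0[where 'a='b] by (metis (mono_tags, lifting) UNIV_eq_I mem_Collect_eq)
    have "poly (map_poly \<phi> g) c = 0" if "g \<in> poly_over B" "poly g a = 0" for g
      using no[of g] that by simp
    then obtain \<psi> where "hom_on (adjoin B a) \<psi>"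
      "\<And>g. g \<in> poly_over B \<Longrightarrow> \<psi> (poly g a) = poly (map_poly \<phi> g) c"
      using hom_on_adjoin[OF B \<phi>(1)] by metis
    then show ?thesis using c p by auto
  qed
qed

text \<open>The weak Nullstellensatz for \<open>\<int>[A]\<close>: separation holds for
  \<open>\<int>\<close> and passes to each adjoined element; applied to \<open>1\<close> it yields a
  homomorphism.\<close>

lemma finite_set_hom:
  fixes A :: "'a::{idom,ring_char_0} set"
  assumes "finite A"
  obtains B and \<phi> :: "'a \<Rightarrow> 'b::{alg_closed_field,field_char_0}"
  where "A \<subseteq> B" "hom_on B \<phi>"
proof -
  have "\<exists>B. unital_subring B \<and> A \<subseteq> B \<and> separated_by_homs B TYPE('b)"
    using assms
  proof (induction A)
    case empty
    then show ?case using unital_subring_Ints separated_Ints by blast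
  next
    case (insert a A)
    then obtain B where B: "unital_subring B" "A \<subseteq> B" "separated_by_homs B TYPE('b)" by blast
    show ?case
      using subring_adjoin[OF B(1)] adjoin_base[OF B(1)] adjoin_elem[OF B(1)] separated_adjoin[OF B(1,3)] B(2)
      by (intro exI[of _ "adjoin B a"]) blast
  qed
  then obtain B where B: "unital_subring B" "A \<subseteq> B" "separated_by_homs B TYPE('b)" by blast
  then obtain \<phi> :: "'a \<Rightarrow> 'b" where "hom_on B \<phi>"
    using subring_1[OF B(1)] unfolding separated_by_homs_def by (metis one_neq_zero)
  then show ?thesis using that B(2) by blast
qed

section \<open>Algebraic numbers\<close>

type_synonym qbar = "rat alg_closure"

text \<open>Places the coefficients of the polynomials given by \<open>alg_closure_algebraic\<close>
  in \<open>\<rat>\<close>.\<close>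

lemma to_ac_eq_of_rat: "to_ac q = of_rat q"
proof -
  obtain a b where "q = of_int a / of_int b"
    by (metis Fract_of_int_quotient Rat_cases)
  then show ?thesis by (simp add: of_rat_divide)
qed

lemma unital_subring_Rats: "unital_subring \<rat>"
  by (auto simp: unital_subring_def)

lemma qbar_min_poly:
  fixes y :: qbar
  assumes "\<rat> \<subseteq> B"
  obtains P where "min_poly_over B y P"
proof -
  obtain p :: "rat poly" where p: "p \<noteq> 0" "poly (map_poly to_ac p) y = 0"
    using alg_closure_algebraic .
  have "map_poly to_ac p \<in> poly_over B"
    using assms by (auto simp: poly_over_def coeff_map_poly to_ac_eq_of_rat)
  moreover have "map_poly to_ac p \<noteq> 0" using p by (simp add: map_poly_eq_0_iff)
  ultimately show ?thesis using min_poly_over_exists p(2) that by metis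
qed

text \<open>If \<open>B\<close> is a field, so is \<open>B[\<theta>]\<close>: a nonzero multiple
  \<open>s * y\<close> lies in \<open>B\<close> and is invertible there.\<close>

lemma adjoin_inverse:
  fixes y :: qbar
  assumes B: "unital_subring B" "\<rat> \<subseteq> B" "\<And>x. x \<in> B \<Longrightarrow> inverse x \<in> B" and y: "y \<in> adjoin B \<theta>"
  shows "inverse y \<in> adjoin B \<theta>"
proof (cases "y = 0")
  case True
  then show ?thesis using y by simp
next
  case False
  obtain P where P: "min_poly_over B \<theta> P" using qbar_min_poly[OF B(2)] .
  obtain s where s: "s \<in> adjoin B \<theta>" "s * y \<in> B" "s * y \<noteq> 0"
    using min_poly_over_inverse[OF B(1) P y False] .
  have "s * inverse (s * y) = inverse y" using s by simp
  moreover have "s * inverse (s * y) \<in> adjoin B \<theta>"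
    using s B(3) adjoin_base[OF B(1)] by (intro subring_mult[OF subring_adjoin[OF B(1)]]) blast+
  ultimately show ?thesis by (simp only:)
qed

lemma hom_on_field_nonzero:
  fixes x :: "'a::field" and \<phi> :: "'a \<Rightarrow> 'b::field"
  assumes "hom_on B \<phi>" "\<And>x. x \<in> B \<Longrightarrow> inverse x \<in> B" "x \<in> B" "x \<noteq> 0"
  shows "\<phi> x \<noteq> 0"
proof
  assume "\<phi> x = 0"
  moreover have "\<phi> (x * inverse x) = \<phi> x * \<phi> (inverse x)"
    using assms by (intro hom_on_mult[OF assms(1)])
  ultimately show False using assms(4) hom_on_1[OF assms(1)] by simp
qed

section \<open>Separability and the primitive element theorem\<close>

lemma min_poly_Rats_pderiv:
  fixes y :: "'a::field_char_0"
  assumes P: "min_poly_over \<rat> y P"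
  shows "poly (pderiv P) y \<noteq> 0"
proof
  assume 0: "poly (pderiv P) y = 0"
  have d: "degree P > 0" using min_poly_over_degree[OF P] .
  then have "pderiv P \<noteq> 0" by (simp add: pderiv_eq_0_iff)
  moreover have "pderiv P \<in> poly_over \<rat>"
    using P by (intro poly_over_pderiv unital_subring_Rats) (simp add: min_poly_over_def)
  ultimately have "degree P \<le> degree (pderiv P)" using P 0 by (simp add: min_poly_over_def)
  then show False using d by (simp add: degree_pderiv)
qed

lemma square_dvd_imp_pderiv_root:
  fixes p :: "'a::field poly"
  assumes "[:- a, 1:] * [:- a, 1:] dvd p"
  shows "poly (pderiv p) a = 0"
proof -
  obtain w where "p = [:- a, 1:] * ([:- a, 1:] * w)" using assms by (metis dvdE mult.assoc)
  then show ?thesis by (simp only: pderiv_mult poly_add poly_mult) simp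
qed

text \<open>The classical argument with \<open>\<theta> = y1 + n * y2\<close>. The minimal
  polynomial \<open>D\<close> of \<open>y2\<close> over \<open>\<rat>(\<theta>)\<close> divides both
  \<open>P2\<close> and \<open>P1(\<theta> - n X)\<close>. The choice of \<open>n\<close> leaves
  \<open>y2\<close> as their only common root, separability makes it simple, so \<open>D\<close> is
  linear.\<close>

lemma primitive_element_pair:
  fixes y1 y2 :: qbar
  obtains \<theta> where "y1 \<in> adjoin \<rat> \<theta>" "y2 \<in> adjoin \<rat> \<theta>"
proof -
  obtain P1 where P1: "min_poly_over \<rat> y1 P1" using qbar_min_poly by blast
  obtain P2 where P2: "min_poly_over \<rat> y2 P2" using qbar_min_poly by blast
  have P1': "P1 \<in> poly_over \<rat>" "P1 \<noteq> 0" "poly P1 y1 = 0" and P2': "P2 \<in> poly_over \<rat>" "P2 \<noteq> 0" "poly P2 y2 = 0"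
    using P1 P2 by (auto simp: min_poly_over_def)
  \<comment> \<open>The values of \<open>n\<close> with
    \<open>y1 + n * y2 = \<alpha> + n * \<beta>\<close> for some \<open>\<beta> \<noteq> y2\<close>.
    Pairs with \<open>\<beta> = y2\<close> contribute \<open>0\<close>, as division by zero gives
    \<open>0\<close>; this excludes only \<open>n = 0\<close>.\<close>
  define bad where "bad = (\<lambda>(\<alpha>, \<beta>). (\<alpha> - y1) / (y2 - \<beta>)) ` ({x. poly P1 x = 0} \<times> {x. poly P2 x = 0})"
  have "finite bad" unfolding bad_def using P1' P2' by (intro finite_imageI finite_cartesian_product poly_roots_finite)
  moreover have "infinite (range (of_nat :: nat \<Rightarrow> qbar))" by (simp add: range_inj_infinite inj_of_nat)
  ultimately obtain n where n: "of_nat n \<notin> bad" by (metis finite_subset image_subsetI)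
  define \<theta> where "\<theta> = y1 + of_nat n * y2"
  define S where "S = adjoin \<rat> \<theta>"
  note Q = unital_subring_Rats
  have S: "unital_subring S" "\<rat> \<subseteq> S" "\<theta> \<in> S" unfolding S_def
    using subring_adjoin[OF Q] adjoin_base[OF Q] adjoin_elem[OF Q] by auto
  have inv: "inverse x \<in> S" if "x \<in> S" for x
    using that unfolding S_def by (intro adjoin_inverse[OF Q]) auto
  obtain D where D: "min_poly_over S y2 D" using qbar_min_poly[OF S(2)] .
  then have D': "D \<in> poly_over S" "D \<noteq> 0" "poly D y2 = 0" by (auto simp: min_poly_over_def)
  have D_dvd: "D dvd g" if g: "g \<in> poly_over S" "poly g y2 = 0" for g
  proof -
    obtain k q where "smult (lead_coeff D ^ k) g = q * D"
      using min_poly_over_divides[OF S(1) D g] by metis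
    then have "D dvd smult (lead_coeff D ^ k) g" by simp
    then show ?thesis using D'(2) by (simp add: dvd_smult_iff)
  qed
  define g where "g = pcompose P1 [:\<theta>, - of_nat n:]"
  have P12: "P1 \<in> poly_over S" "P2 \<in> poly_over S" using poly_over_mono[OF S(2)] P1' P2' by auto
  have "[:\<theta>, - of_nat n:] \<in> poly_over S"
    using S subring_0[OF S(1)] subring_uminus[OF S(1) subring_of_nat[OF S(1)]]
    by (auto simp: poly_over_def coeff_pCons split: nat.splits)
  then have "g \<in> poly_over S" unfolding g_def using P12 by (intro poly_over_pcompose[OF S(1)])
  moreover have "poly g y2 = 0" using P1' by (simp add: g_def poly_pcompose \<theta>_def)
  ultimately have Dg: "D dvd g" using D_dvd by blast
  have DP2: "D dvd P2" using D_dvd P12 P2' by blast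
  have root: "\<beta> = y2" if "poly D \<beta> = 0" for \<beta>
  proof (rule ccontr)
    assume neq: "\<beta> \<noteq> y2"
    have b: "poly P2 \<beta> = 0" "poly g \<beta> = 0" using Dg DP2 that by (auto elim!: dvdE)
    then have "poly P1 (y1 + of_nat n * (y2 - \<beta>)) = 0"
      by (simp add: g_def poly_pcompose \<theta>_def algebra_simps)
    then have "((y1 + of_nat n * (y2 - \<beta>)) - y1) / (y2 - \<beta>) \<in> bad"
      unfolding bad_def using b by force
    then show False using n neq by simp
  qed
  obtain E where E: "D = [:- y2, 1:] * E" using D'(3) by (auto simp: poly_eq_0_iff_dvd elim: dvdE)
  have "degree E = 0"
  proof (rule ccontr)
    assume "degree E \<noteq> 0"
    then obtain \<beta> where "poly E \<beta> = 0" using alg_closed_imp_poly_has_root by blast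
    then have "poly E y2 = 0" using root[of \<beta>] E by simp
    then have "[:- y2, 1:] * [:- y2, 1:] dvd D" unfolding E
      by (intro mult_dvd_mono) (auto simp: poly_eq_0_iff_dvd)
    then have "poly (pderiv P2) y2 = 0" using DP2 square_dvd_imp_pderiv_root dvd_trans by blast
    then show False using min_poly_Rats_pderiv[OF P2] by simp
  qed
  then obtain e where e: "E = [:e:]" by (metis degree_eq_zeroE)
  \<comment> \<open>Now \<open>D = e * (X - y2)\<close>, so up to sign \<open>y2\<close> is the
    quotient of its two coefficients.\<close>
  have "coeff D 0 \<in> S" "coeff D 1 \<in> S" using D' by (auto simp: poly_over_def)
  then have De: "- (y2 * e) \<in> S" "e \<in> S" "e \<noteq> 0" using E e D'(2) by (auto simp: mult.commute)
  have "- (- (y2 * e) * inverse e) \<in> S"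
    using subring_uminus[OF S(1) subring_mult[OF S(1) De(1) inv[OF De(2)]]] .
  then have y2: "y2 \<in> S" using De by (simp add: mult.assoc)
  have "\<theta> - of_nat n * y2 \<in> S" using S y2
    by (intro subring_diff[OF S(1)] subring_mult[OF S(1)] subring_of_nat[OF S(1)])
  then have "y1 \<in> S" by (simp add: \<theta>_def)
  then show ?thesis using y2 that unfolding S_def by blast
qed

lemma primitive_element:
  assumes "finite (Y :: qbar set)"
  obtains \<theta> where "Y \<subseteq> adjoin \<rat> \<theta>"
proof -
  have "\<exists>\<theta>. Y \<subseteq> adjoin \<rat> \<theta>" using assms
  proof (induction Y)
    case (insert y Y)
    then obtain \<theta>0 where \<theta>0: "Y \<subseteq> adjoin \<rat> \<theta>0" by blast
    obtain \<theta> where \<theta>: "\<theta>0 \<in> adjoin \<rat> \<theta>" "y \<in> adjoin \<rat> \<theta>" using primitive_element_pair .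
    have "adjoin \<rat> \<theta>0 \<subseteq> adjoin \<rat> \<theta>"
      using \<theta> by (intro adjoin_least subring_adjoin adjoin_base unital_subring_Rats)
    then show ?case using \<theta>0 \<theta> by blast
  qed simp
  then show ?thesis using that by blast
qed

section \<open>Conjugates and embeddings of number fields\<close>

lemma qbar_other_conjugate:
  fixes y :: qbar
  assumes "y \<notin> \<rat>" and P: "min_poly_over \<rat> y P"
  obtains y' where "poly P y' = 0" "y' \<noteq> y"
proof -
  have P': "P \<in> poly_over \<rat>" "P \<noteq> 0" "poly P y = 0"
    using P by (auto simp: min_poly_over_def)
  then obtain E where E: "P = [:- y, 1:] * E" by (auto simp: poly_eq_0_iff_dvd elim: dvdE)
  \<comment> \<open>A constant \<open>E\<close> would make \<open>P\<close> linear with rational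
    coefficients and hence \<open>y\<close> rational.\<close>
  have "degree E \<noteq> 0"
  proof
    assume "degree E = 0"
    then obtain e where e: "E = [:e:]" by (metis degree_eq_zeroE)
    have "coeff P 0 \<in> \<rat>" "coeff P 1 \<in> \<rat>" using P' by (auto simp: poly_over_def)
    then have "- (y * e) \<in> \<rat>" "e \<in> \<rat>" "e \<noteq> 0" using E e P'(2) by (auto simp: mult.commute)
    then have "(y * e) / e \<in> \<rat>" by (intro Rats_divide) auto
    then show False using \<open>e \<noteq> 0\<close> assms(1) by simp
  qed
  then obtain y' where y': "poly E y' = 0" using alg_closed_imp_poly_has_root by blast
  \<comment> \<open>Otherwise \<open>y\<close> would be a double root of \<open>P\<close>, against
    separability.\<close>
  moreover have "y' \<noteq> y"
  proof
    assume "y' = y"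
    then have "[:- y, 1:] * [:- y, 1:] dvd P" unfolding E using y'
      by (intro mult_dvd_mono) (auto simp: poly_eq_0_iff_dvd)
    then show False using min_poly_Rats_pderiv[OF P] square_dvd_imp_pderiv_root by blast
  qed
  ultimately show ?thesis using that E by simp
qed

text \<open>First \<open>y\<close> goes to another root of its minimal polynomial. To extend over
  \<open>\<theta>\<close>, transport the minimal polynomial of \<open>\<theta>\<close>: its degree
  stays positive, as homomorphisms of fields are injective, so it has a root.\<close>

lemma qbar_conjugation:
  fixes y \<theta> :: qbar
  assumes "y \<notin> \<rat>"
  obtains \<sigma> :: "qbar \<Rightarrow> qbar" where "hom_on (adjoin (adjoin \<rat> y) \<theta>) \<sigma>" "\<sigma> y \<noteq> y"
proof -
  note Q = unital_subring_Rats
  obtain P where P: "min_poly_over \<rat> y P" using qbar_min_poly by blast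
  then have P': "P \<in> poly_over \<rat>" "P \<noteq> 0" by (auto simp: min_poly_over_def)
  obtain y' where y': "poly P y' = 0" "y' \<noteq> y" using qbar_other_conjugate[OF assms P] .
  have id: "hom_on \<rat> (\<lambda>x::qbar. x)" by (simp add: hom_on_def)
  obtain \<tau> where \<tau>: "hom_on (adjoin \<rat> y) \<tau>" "\<And>g. g \<in> poly_over \<rat> \<Longrightarrow> \<tau> (poly g y) = poly g y'"
    using hom_on_adjoin_algebraic[OF Q id P, of y'] P' y' by auto
  define B where "B = adjoin \<rat> y"
  have B: "unital_subring B" "\<rat> \<subseteq> B" "y \<in> B" unfolding B_def
    using subring_adjoin[OF Q] adjoin_base[OF Q] adjoin_elem[OF Q] by auto
  have inv: "inverse x \<in> B" if "x \<in> B" for x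
    using that unfolding B_def by (intro adjoin_inverse[OF Q]) auto
  have \<tau>B: "hom_on B \<tau>" using \<tau>(1) by (simp add: B_def)
  obtain R where R: "min_poly_over B \<theta> R" using qbar_min_poly[OF B(2)] .
  then have l: "lead_coeff R \<in> B" "lead_coeff R \<noteq> 0" by (auto simp: min_poly_over_def poly_over_def)
  have nz: "\<tau> (lead_coeff R) \<noteq> 0" using hom_on_field_nonzero[OF \<tau>B inv l] .
  then have "coeff (map_poly \<tau> R) (degree R) \<noteq> 0" by (simp add: coeff_map_poly hom_on_0[OF B(1) \<tau>B])
  then have "degree (map_poly \<tau> R) > 0" using le_degree min_poly_over_degree[OF R] by fastforce
  then obtain c where c: "poly (map_poly \<tau> R) c = 0" using alg_closed_imp_poly_has_root by blast
  obtain \<sigma> where \<sigma>: "hom_on (adjoin B \<theta>) \<sigma>"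
    "\<And>g. g \<in> poly_over B \<Longrightarrow> \<sigma> (poly g \<theta>) = poly (map_poly \<tau> g) c"
    using hom_on_adjoin_algebraic[OF B(1) \<tau>B R nz c] by blast
  have "\<sigma> y = \<tau> y"
    using \<sigma>(2)[OF poly_over_const[OF B(1,3)]] by (simp add: map_poly_pCons hom_on_0[OF B(1) \<tau>B])
  also have "\<tau> y = y'" using \<tau>(2)[OF poly_over_X[OF Q]] by simp
  finally show ?thesis using that \<sigma>(1) y' unfolding B_def by blast
qed

text \<open>Since \<open>\<rat>(\<theta>)\<close> is generated by \<open>\<theta>\<close>, one root
  in the target field of the minimal polynomial of \<open>\<theta>\<close> is enough.\<close>

lemma qbar_hom_if_roots:
  fixes \<theta> :: qbar
  assumes roots: "\<And>p::rat poly. degree p > 0 \<Longrightarrow> \<exists>x::'a::field_char_0. poly (map_poly of_rat p) x = 0"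
  obtains \<psi> :: "qbar \<Rightarrow> 'a::field_char_0" where "hom_on (adjoin \<rat> \<theta>) \<psi>" "\<And>q. \<psi> (of_rat q) = of_rat q"
proof -
  note Q = unital_subring_Rats
  let ?i = "inv_into UNIV of_rat :: qbar \<Rightarrow> rat"
  define \<rho> :: "qbar \<Rightarrow> 'a" where "\<rho> = of_rat \<circ> ?i"
  have inv: "?i (of_rat q) = q" for q by (simp add: inj_on_def)
  have inv0: "?i 0 = 0" using inv[of 0] by simp
  have \<rho>: "hom_on \<rat> \<rho>" unfolding hom_on_def Rats_def \<rho>_def
    using inv[of 1] by (auto simp: inv of_rat_add of_rat_mult simp flip: of_rat_add of_rat_mult)
  obtain P where P: "min_poly_over \<rat> \<theta> P" using qbar_min_poly by blast
  then have P': "P \<in> poly_over \<rat>" "P \<noteq> 0" by (auto simp: min_poly_over_def)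
  \<comment> \<open>The assumption \<open>roots\<close> speaks of \<open>rat poly\<close>, so the
    coefficients of \<open>P\<close> are pulled back along \<open>of_rat\<close>.\<close>
  define p where "p = map_poly ?i P"
  have "P = map_poly of_rat p"
  proof (rule poly_eqI)
    fix n
    have "coeff P n \<in> \<rat>" using P' by (simp add: poly_over_def)
    then show "coeff P n = coeff (map_poly of_rat p) n"
      by (auto simp: p_def coeff_map_poly inv0 inv elim!: Rats_cases)
  qed
  then have "degree P = degree p" by (simp add: degree_map_poly)
  then obtain x :: 'a where x: "poly (map_poly of_rat p) x = 0"
    using roots[of p] min_poly_over_degree[OF P] by auto
  have "map_poly \<rho> P = map_poly of_rat p" by (simp add: \<rho>_def p_def map_poly_map_poly inv0)
  then have c: "poly (map_poly \<rho> P) x = 0" using x by simp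
  have l: "lead_coeff P \<in> \<rat>" "lead_coeff P \<noteq> 0" using P' by (auto simp: poly_over_def)
  then have nz: "\<rho> (lead_coeff P) \<noteq> 0" using hom_on_field_nonzero[OF \<rho>] by simp
  obtain \<psi> where \<psi>: "hom_on (adjoin \<rat> \<theta>) \<psi>"
    "\<And>g. g \<in> poly_over \<rat> \<Longrightarrow> \<psi> (poly g \<theta>) = poly (map_poly \<rho> g) x"
    using hom_on_adjoin_algebraic[OF Q \<rho> P nz c] by blast
  have "\<psi> (of_rat q) = of_rat q" for q
    using \<psi>(2)[OF poly_over_const[OF Q], of "of_rat q"] hom_on_0[OF Q \<rho>]
    by (simp add: map_poly_pCons) (simp add: \<rho>_def inv)
  then show ?thesis using that \<psi>(1) by blast
qed

text \<open>Homomorphisms that lead from \<open>A\<close> through the algebraic numbers back into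
  the field satisfy the conditions of adequacy, so all of them fix \<open>r\<close>.\<close>

lemma Ktilde_rational_if_roots:
  fixes r :: "'a::field_char_0"
  assumes r: "r \<in> Ktilde"
    and roots: "\<And>p::rat poly. degree p > 0 \<Longrightarrow> \<exists>x::'a. poly (map_poly of_rat p) x = 0"
  shows "r \<in> \<rat>"
proof (rule ccontr)
  assume irr: "r \<notin> \<rat>"
  note Q = unital_subring_Rats
  obtain A where A: "adequate_for r A" using r by (auto simp: Ktilde_def)
  then have fin: "finite A" and rA: "r \<in> A" by (auto simp: adequate_for_def)
  \<comment> \<open>Adequacy for maps that respect all sums and products of elements of
    \<open>A\<close>, also those outside \<open>A\<close>; composites of homomorphisms do.\<close>
  have fixed: "f r = r"
    if "f 1 = 1" "\<And>a b. a \<in> A \<Longrightarrow> b \<in> A \<Longrightarrow> f (a + b) = f a + f b \<and> f (a * b) = f a * f b" for f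
    using A that unfolding adequate_for_def by blast
  obtain B and \<phi> :: "'a \<Rightarrow> qbar" where B: "A \<subseteq> B" "hom_on B \<phi>" using finite_set_hom[OF fin] .
  obtain \<theta> where \<theta>: "\<phi> ` A \<subseteq> adjoin \<rat> \<theta>"
    using primitive_element[OF finite_imageI[OF fin]] .
  show False
  proof (cases "\<phi> r \<in> \<rat>")
    case True
    obtain \<psi> :: "qbar \<Rightarrow> 'a" where \<psi>: "hom_on (adjoin \<rat> \<theta>) \<psi>" "\<And>q. \<psi> (of_rat q) = of_rat q"
      using qbar_hom_if_roots[OF roots] by blast
    have "(\<psi> \<circ> \<phi>) r = r"
      using \<theta> subsetD[OF B(1)]
      by (intro fixed[of "\<psi> \<circ> \<phi>"]) (auto simp: image_subset_iff hom_on_1[OF \<psi>(1)] hom_on_add[OF \<psi>(1)]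
          hom_on_mult[OF \<psi>(1)] hom_on_1[OF B(2)] hom_on_add[OF B(2)] hom_on_mult[OF B(2)])
    then show False using True \<psi>(2) irr by (auto elim!: Rats_cases)
  next
    case False
    define C where "C = adjoin (adjoin \<rat> (\<phi> r)) \<theta>"
    obtain \<sigma> :: "qbar \<Rightarrow> qbar" where \<sigma>: "hom_on C \<sigma>" "\<sigma> (\<phi> r) \<noteq> \<phi> r"
      unfolding C_def using qbar_conjugation[OF False] .
    have sub: "unital_subring (adjoin \<rat> (\<phi> r))" using subring_adjoin[OF Q] .
    have "adjoin \<rat> \<theta> \<subseteq> C" unfolding C_def
      using subset_trans[OF adjoin_base[OF Q] adjoin_base[OF sub]]
      by (rule adjoin_least[OF subring_adjoin[OF sub] _ adjoin_elem[OF sub]])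
    then have \<phi>C: "\<phi> ` A \<subseteq> C" using \<theta> by blast
    \<comment> \<open>A single field containing the images of \<open>A\<close> under
      \<open>\<phi>\<close> and under \<open>\<sigma> \<circ> \<phi>\<close>, so that the same
      \<open>\<psi>\<close> can follow both.\<close>
    obtain \<eta> where \<eta>: "\<phi> ` A \<union> \<sigma> ` \<phi> ` A \<subseteq> adjoin \<rat> \<eta>"
      using primitive_element[OF finite_UnI[OF finite_imageI[OF fin] finite_imageI[OF finite_imageI[OF fin]]]] .
    obtain \<psi> :: "qbar \<Rightarrow> 'a" where \<psi>: "hom_on (adjoin \<rat> \<eta>) \<psi>"
      using qbar_hom_if_roots[OF roots] by blast
    have "(\<psi> \<circ> \<phi>) r = r"
      using \<eta> subsetD[OF B(1)]
      by (intro fixed[of "\<psi> \<circ> \<phi>"]) (auto simp: image_subset_iff hom_on_1[OF \<psi>] hom_on_add[OF \<psi>]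
          hom_on_mult[OF \<psi>] hom_on_1[OF B(2)] hom_on_add[OF B(2)] hom_on_mult[OF B(2)])
    moreover have "(\<psi> \<circ> \<sigma> \<circ> \<phi>) r = r"
      using \<eta> \<phi>C subsetD[OF B(1)]
      by (intro fixed[of "\<psi> \<circ> \<sigma> \<circ> \<phi>"]) (auto simp: image_subset_iff hom_on_1[OF \<psi>] hom_on_add[OF \<psi>]
          hom_on_mult[OF \<psi>] hom_on_1[OF B(2)] hom_on_add[OF B(2)] hom_on_mult[OF B(2)]
          hom_on_1[OF \<sigma>(1)] hom_on_add[OF \<sigma>(1)] hom_on_mult[OF \<sigma>(1)])
    moreover have mem: "\<sigma> (\<phi> r) \<in> adjoin \<rat> \<eta>" "\<phi> r \<in> adjoin \<rat> \<eta>" using \<eta> rA by auto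
    \<comment> \<open>Both composites fix \<open>r\<close>, so \<open>\<psi>\<close> kills a nonzero
      element of a field, which is impossible.\<close>
    ultimately have "\<psi> (\<sigma> (\<phi> r) - \<phi> r) = 0"
      using hom_on_diff[OF subring_adjoin[OF Q] \<psi>] by simp
    moreover have "\<sigma> (\<phi> r) - \<phi> r \<in> adjoin \<rat> \<eta>"
      using mem by (intro subring_diff[OF subring_adjoin[OF Q]])
    ultimately show False
      using hom_on_field_nonzero[OF \<psi> adjoin_inverse[OF Q]] \<sigma>(2) by simp
  qed
qed

section \<open>Merging a system into one equation\<close>

fun qpow :: "qpoly \<Rightarrow> nat \<Rightarrow> qpoly" where
  "qpow p 0 = QConst 1"
| "qpow p (Suc n) = QMul p (qpow p n)"

lemma qeval_qpow: "qeval v (qpow p n) = qeval v p ^ n"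
  by (induction n) auto

lemma qvars_qpow: "qvars (qpow p n) \<subseteq> qvars p"
  by (induction n) auto

text \<open>For \<open>c\<close> the coefficients of a polynomial of degree \<open>n\<close>, this
  is its homogenization at \<open>p\<close>, \<open>q\<close>. Multiplying by \<open>q\<close>
  raises the degree of the lower part before the new top term joins.\<close>

fun qform :: "(nat \<Rightarrow> rat) \<Rightarrow> qpoly \<Rightarrow> qpoly \<Rightarrow> nat \<Rightarrow> qpoly" where
  "qform c p q 0 = QConst (c 0)"
| "qform c p q (Suc n) = QAdd (QMul q (qform c p q n)) (QMul (QConst (c (Suc n))) (qpow p (Suc n)))"

lemma qeval_qform:
  "qeval v (qform c p q n) = (\<Sum>i\<le>n. of_rat (c i) * qeval v p ^ i * qeval v q ^ (n - i))"
proof (induction n)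
  case (Suc n)
  have "qeval v q * (\<Sum>i\<le>n. of_rat (c i) * qeval v p ^ i * qeval v q ^ (n - i)) =
    (\<Sum>i\<le>n. of_rat (c i) * qeval v p ^ i * qeval v q ^ (Suc n - i))"
    unfolding sum_distrib_left by (intro sum.cong) (auto simp: Suc_diff_le mult_ac)
  then show ?case using Suc by (simp add: qeval_qpow)
qed simp

lemma qvars_qform: "qvars (qform c p q n) \<subseteq> qvars p \<union> qvars q"
  by (induction n) (use qvars_qpow in auto)

text \<open>If the value of \<open>t\<close> is nonzero, dividing by its power exhibits the quotient
  as a root of \<open>p\<close>. If it is zero, only the leading term remains and forces
  \<open>s\<close> to vanish too.\<close>

lemma qform_anisotropic:
  fixes p :: "rat poly" and v :: "nat \<Rightarrow> 'a::field_char_0"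
  assumes deg: "degree p > 0" and no_root: "\<And>x::'a. poly (map_poly of_rat p) x \<noteq> 0"
  shows "qeval v (qform (coeff p) s t (degree p)) = 0 \<longleftrightarrow> qeval v s = 0 \<and> qeval v t = 0"
proof
  let ?x = "qeval v s" and ?y = "qeval v t" and ?n = "degree p"
  assume "qeval v (qform (coeff p) s t ?n) = 0"
  then have sum0: "(\<Sum>i\<le>?n. of_rat (coeff p i) * ?x ^ i * ?y ^ (?n - i)) = 0"
    by (simp add: qeval_qform)
  have y: "?y = 0"
  proof (rule ccontr)
    assume y: "?y \<noteq> 0"
    have "?y ^ ?n * poly (map_poly of_rat p) (?x / ?y) =
      (\<Sum>i\<le>?n. ?y ^ ?n * (of_rat (coeff p i) * (?x / ?y) ^ i))"
      by (simp add: poly_altdef degree_map_poly coeff_map_poly sum_distrib_left)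
    also have "\<dots> = (\<Sum>i\<le>?n. of_rat (coeff p i) * ?x ^ i * ?y ^ (?n - i))"
      using y by (intro sum.cong) (auto simp: power_divide power_diff)
    finally show False using sum0 y no_root by simp
  qed
  have "(\<Sum>i\<le>?n. of_rat (coeff p i) * ?x ^ i * ?y ^ (?n - i)) =
    (\<Sum>i\<in>{?n}. of_rat (coeff p i) * ?x ^ i * ?y ^ (?n - i))"
    using y by (intro sum.mono_neutral_right) auto
  then have "of_rat (lead_coeff p) * ?x ^ ?n = 0" using sum0 by simp
  then have "?x = 0" using deg by auto
  then show "?x = 0 \<and> ?y = 0" using y by simp
next
  assume "qeval v s = 0 \<and> qeval v t = 0"
  then show "qeval v (qform (coeff p) s t (degree p)) = 0"
    using deg by (auto simp: qeval_qform power_0_left intro!: sum.neutral)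
qed

text \<open>The anisotropic form expresses the conjunction of two equations; nesting it handles
  \<open>E\<close>, starting from \<open>QConst 0\<close> for the empty system.\<close>

lemma finite_system_single_equation:
  fixes p :: "rat poly" and E :: "qpoly set"
  assumes "degree p > 0" "\<And>x::'a::field_char_0. poly (map_poly of_rat p) x \<noteq> 0" and "finite E"
  obtains T where "qvars T \<subseteq> \<Union> (qvars ` E)"
    "\<And>v :: nat \<Rightarrow> 'a. qeval v T = 0 \<longleftrightarrow> (\<forall>e\<in>E. qeval v e = 0)"
proof -
  have "\<exists>T. qvars T \<subseteq> \<Union> (qvars ` E) \<and> (\<forall>v :: nat \<Rightarrow> 'a. qeval v T = 0 \<longleftrightarrow> (\<forall>e\<in>E. qeval v e = 0))"
    using assms(3)
  proof (induction E)
    case empty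
    then show ?case by (intro exI[of _ "QConst 0"]) simp
  next
    case (insert e E)
    then obtain T where T: "qvars T \<subseteq> \<Union> (qvars ` E)"
      "\<And>v :: nat \<Rightarrow> 'a. qeval v T = 0 \<longleftrightarrow> (\<forall>e\<in>E. qeval v e = 0)" by blast
    show ?case
      using T(1) qvars_qform[of "coeff p" e T "degree p"]
      by (intro exI[of _ "qform (coeff p) e T (degree p)"]) (auto simp: qform_anisotropic[OF assms(1,2)] T(2))
  qed
  then show ?thesis using that by blast
qed

section \<open>Variables indexed by the adequate set\<close>

lemma enumerate_from:
  assumes "finite A" "r \<in> A"
  obtains e :: "'a \<Rightarrow> nat" where "inj_on e A" "e r = 0" "e ` A \<subseteq> {0..card A}"
proof -
  obtain h where h: "bij_betw h (A - {r}) {0..<card (A - {r})}"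
    using ex_bij_betw_finite_nat[of "A - {r}"] assms by auto
  \<comment> \<open>Index \<open>0\<close> is reserved for \<open>r\<close>, the variable
    \<open>x\<close> of the theorem; the other indices shift up by one.\<close>
  define e where "e a = (if a = r then 0 else Suc (h a))" for a
  have "inj_on e A" using h unfolding inj_on_def bij_betw_def e_def by auto
  moreover have "e a \<le> card A" if "a \<in> A" for a
  proof (cases "a = r")
    case False
    then have "h a \<in> {0..<card (A - {r})}" using h that by (auto simp: bij_betw_def)
    then have "h a < card (A - {r})" by simp
    also have "\<dots> < card A" using assms by (rule card_Diff1_less)
    finally show ?thesis by (simp add: e_def)
  qed (simp add: e_def)
  moreover have "e r = 0" by (simp add: e_def)
  ultimately show ?thesis using that[of e] by (simp add: image_subset_iff)
qed

definition qdiff :: "qpoly \<Rightarrow> qpoly \<Rightarrow> qpoly" where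
  "qdiff p q = QAdd p (QMul (QConst (-1)) q)"

lemma qeval_qdiff [simp]: "qeval v (qdiff p q) = qeval v p - qeval v q"
  by (simp add: qdiff_def of_rat_minus)

lemma qvars_qdiff [simp]: "qvars (qdiff p q) = qvars p \<union> qvars q"
  by (simp add: qdiff_def)

text \<open>Through \<open>e\<close>, assignments of the variables become maps on \<open>A\<close>,
  and the solutions of the system are the maps named in the definition of adequacy. Adequacy
  determines their value at \<open>r\<close>; the identity shows that \<open>r\<close> is
  attained.\<close>

lemma single_equation_if_no_root:
  fixes r :: "'a::field_char_0" and p :: "rat poly"
  assumes r: "r \<in> Ktilde" and p: "degree p > 0" "\<And>x::'a. poly (map_poly of_rat p) x \<noteq> 0"
  obtains m T where "m \<ge> 1" "qvars T \<subseteq> {0..m}"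
    "\<And>x::'a. x = r \<longleftrightarrow> (\<exists>xs::nat \<Rightarrow> 'a. qeval (xs(0 := x)) T = 0)"
proof -
  obtain A where A: "adequate_for r A" using r by (auto simp: Ktilde_def)
  then have fin: "finite A" and rA: "r \<in> A" by (auto simp: adequate_for_def)
  obtain e :: "'a \<Rightarrow> nat" where e: "inj_on e A" "e r = 0" "e ` A \<subseteq> {0..card A}"
    using enumerate_from[OF fin rA] .
  let ?x = "\<lambda>a. QVar (e a)"
  \<comment> \<open>The first index set is empty unless \<open>1 \<in> A\<close>, which encodes the
    condition on \<open>f 1\<close>.\<close>
  define E where "E = (\<lambda>a. qdiff (?x a) (QConst 1)) ` {a\<in>A. a = 1}
    \<union> (\<lambda>(a, b). qdiff (?x (a + b)) (QAdd (?x a) (?x b))) ` {(a, b) \<in> A \<times> A. a + b \<in> A}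
    \<union> (\<lambda>(a, b). qdiff (?x (a * b)) (QMul (?x a) (?x b))) ` {(a, b) \<in> A \<times> A. a * b \<in> A}"
  have "finite E" unfolding E_def using fin
    by (intro finite_UnI finite_imageI) (auto intro: finite_subset[of _ "A \<times> A"])
  then obtain T where T: "qvars T \<subseteq> \<Union> (qvars ` E)"
    "\<And>v :: nat \<Rightarrow> 'a. qeval v T = 0 \<longleftrightarrow> (\<forall>e\<in>E. qeval v e = 0)"
    using finite_system_single_equation[OF p] by metis
  have sol: "qeval v T = 0 \<longleftrightarrow> (1 \<in> A \<longrightarrow> v (e 1) = 1) \<and>
      (\<forall>a\<in>A. \<forall>b\<in>A. a + b \<in> A \<longrightarrow> v (e (a + b)) = v (e a) + v (e b)) \<and>
      (\<forall>a\<in>A. \<forall>b\<in>A. a * b \<in> A \<longrightarrow> v (e (a * b)) = v (e a) * v (e b))" for v :: "nat \<Rightarrow> 'a"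
    unfolding T(2) E_def ball_Un by auto
  have unique: "v 0 = r" if "qeval v T = 0" for v :: "nat \<Rightarrow> 'a"
  proof -
    have "v (e r) = r" using A that unfolding sol adequate_for_def
      by (elim conjE allE[of _ "\<lambda>a. v (e a)"]) simp
    then show ?thesis using e(2) by simp
  qed
  show ?thesis
  proof (rule that)
    \<comment> \<open>The indices only reach \<open>card A - 1\<close>; the larger bound gives
      \<open>m \<ge> 1\<close> even for \<open>A = {r}\<close>.\<close>
    show "card A \<ge> 1" using fin rA card_gt_0_iff[of A] by auto
    have "\<Union> (qvars ` E) \<subseteq> e ` A" by (auto simp: E_def)
    then show "qvars T \<subseteq> {0..card A}" using T(1) e(3) by blast
    fix x :: 'a
    show "x = r \<longleftrightarrow> (\<exists>xs::nat \<Rightarrow> 'a. qeval (xs(0 := x)) T = 0)"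
    proof
      assume x: "x = r"
      \<comment> \<open>The identity on \<open>A\<close> read as an assignment. The update at
        \<open>0\<close> agrees with it, as \<open>e r = 0\<close> and \<open>x = r\<close>.\<close>
      define v where "v = (inv_into A e)(0 := x)"
      have "v (e a) = a" if "a \<in> A" for a
        using e that x inv_into_f_f[OF e(1) that] inj_onD[OF e(1), of a r] rA by (auto simp: v_def)
      then have "qeval v T = 0" unfolding sol by simp
      then show "\<exists>xs::nat \<Rightarrow> 'a. qeval (xs(0 := x)) T = 0" unfolding v_def by blast
    next
      assume "\<exists>xs::nat \<Rightarrow> 'a. qeval (xs(0 := x)) T = 0"
      then show "x = r" using unique by force
    qed
  qed
qed

theorem theorem5:
  fixes r :: "'a::field_char_0"
  assumes "r \<in> Ktilde"
  shows "\<exists>m::nat. m \<ge> 1 \<and> (\<exists>T::qpoly. qvars T \<subseteq> {0..m} \<and>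
           (\<forall>x::'a. x = r \<longleftrightarrow>
              (\<exists>xs::nat \<Rightarrow> 'a. qeval (xs(0 := x)) T = 0)))"
proof (cases "\<exists>p::rat poly. degree p > 0 \<and> (\<forall>x::'a. poly (map_poly of_rat p) x \<noteq> 0)")
  case True
  then show ?thesis using single_equation_if_no_root[OF assms] by metis
next
  case False
  then have "r \<in> \<rat>" by (intro Ktilde_rational_if_roots[OF assms]) blast
  then obtain q where "r = of_rat q" by (auto elim: Rats_cases)
  then show ?thesis
    by (intro exI[of _ 1] conjI exI[of _ "qdiff (QVar 0) (QConst q)"]) auto
qed

end
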